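(* Let $K$ be a field, let $n, m \geq 1$ be integers, and let $f(x_1,\dots,x_m)\in K\langle X\rangle$ be a multilinear polynomial. Endow $M_n(K)$ with the Vasilovsky $\mathbb{Z}_n$-grading. Then $f$ is a polynomial identity for $M_n(K)$ if and only if the following holds: whenever $a_1,\dots,a_m\in M_n(K)$ are homogeneous matrices satisfying $\sum_{i=1}^m \deg(a_i)=0$ in $\mathbb{Z}_n$, one has $f(a_1,\dots,a_m)=0$.
   Context: $K\langle X\rangle$ is the free associative $K$-algebra on a countable set $X$ of noncommuting variables. A polynomial $f(x_1,\dots,x_m)\in K\langle X\rangle$ is multilinear if $f=\sum_{\sigma\in S_m}\alpha_\sigma x_{\sigma(1)}\cdots x_{\sigma(m)}$ with $\alpha_\sigma\in K$. It is a polynomial identity for $M_n(K)$ if $f(b_1,\dots,b_m)=0$ for all $b_1,\dots,b_m\in M_n(K)$. The Vasilovsky grading is $M_n(K)=\bigoplus_{g\in\mathbb{Z}_n}A_g$, where $A_g$ is the span of the matrix units $E_{i,j}$ with $j-i\equiv g \pmod n$. A matrix $a$ is homogeneous of degree $g$, written $\deg(a)=g$, if $a\in A_g$. *)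

theory Defs
  imports
    "HOL-Library.Poly_Mapping"
    "HOL-Combinatorics.Permutations"
    "HOL-Number_Theory.Cong"
    "Jordan_Normal_Form.VS_Connect"
begin

text \<open>The free monoid on the countable set of variables \<open>x\<^sub>0, x\<^sub>1, x\<^sub>2, \<dots>\<close>, written additively
  because the index monoid of a type of finitely supported functions \<open>_ \<Rightarrow>\<^sub>0 _\<close> has to be
  in class \<^class>\<open>monoid_add\<close>; the monoid is not commutative. The wrapper keeps the
  instance off the type of lists.\<close>

datatype nc_word = Word (letters: "nat list")

instantiation nc_word :: monoid_add
begin

definition zero_nc_word :: nc_word where "0 = Word []"

definition plus_nc_word :: "nc_word \<Rightarrow> nc_word \<Rightarrow> nc_word"
  where "u + v = Word (letters u @ letters v)"

instance
  by standard (simp_all add: zero_nc_word_def plus_nc_word_def)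

end

text \<open>The monoid algebra of the free monoid is the free associative unital algebra; its
  addition and convolution product are those of \<^theory>\<open>HOL-Library.Poly_Mapping\<close>.\<close>

type_synonym 'k free_algebra = "nc_word \<Rightarrow>\<^sub>0 'k"

definition Var :: "nat \<Rightarrow> 'k::semiring_1 free_algebra"
  where "Var i = Poly_Mapping.single (Word [i]) 1"

definition Const :: "'k::semiring_1 \<Rightarrow> 'k free_algebra"
  where "Const c = Poly_Mapping.single 0 c"

definition multilinear :: "nat \<Rightarrow> 'k::field free_algebra \<Rightarrow> bool"
  where "multilinear m f \<longleftrightarrow>
    (\<exists>\<alpha>. f = (\<Sum>\<sigma> | \<sigma> permutes {1..m}. Const (\<alpha> \<sigma>) * (\<Prod>i\<leftarrow>[1..<Suc m]. Var (\<sigma> i))))"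

text \<open>\<open>poly_eval n a f\<close> is \<open>f\<close> with the \<open>n \<times> n\<close> matrix \<open>a i\<close> substituted for \<open>x\<^sub>i\<close>. The type of
  matrices carries all dimensions at once and has no global zero, so the sum over the monomials
  is taken in the module of \<open>n \<times> n\<close> matrices.\<close>

definition word_eval :: "nat \<Rightarrow> (nat \<Rightarrow> 'k::field mat) \<Rightarrow> nc_word \<Rightarrow> 'k mat"
  where "word_eval n a w = foldr (\<lambda>i M. a i * M) (letters w) (1\<^sub>m n)"

definition poly_eval :: "nat \<Rightarrow> (nat \<Rightarrow> 'k::field mat) \<Rightarrow> 'k free_algebra \<Rightarrow> 'k mat"
  where "poly_eval n a f =
    (\<Oplus>\<^bsub>module_mat TYPE('k) n n\<^esub> w \<in> Poly_Mapping.keys f.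
      Poly_Mapping.lookup f w \<cdot>\<^sub>m word_eval n a w)"

definition polynomial_identity :: "nat \<Rightarrow> nat \<Rightarrow> 'k::field free_algebra \<Rightarrow> bool"
  where "polynomial_identity n m f \<longleftrightarrow>
    (\<forall>b. (\<forall>i\<in>{1..m}. b i \<in> carrier_mat n n) \<longrightarrow> poly_eval n b f = 0\<^sub>m n n)"

text \<open>Rows and columns are numbered from \<open>0\<close>; only the difference \<open>j - i\<close> enters the grading, so
  this agrees with numbering from \<open>1\<close>. A degree in \<open>\<int>\<^sub>n\<close> is given by any integer representative.\<close>

definition matrix_unit :: "nat \<Rightarrow> nat \<Rightarrow> nat \<Rightarrow> 'k::field mat"
  where "matrix_unit n i j = mat n n (\<lambda>(k, l). if k = i \<and> l = j then 1 else 0)"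

definition vasilovsky :: "nat \<Rightarrow> int \<Rightarrow> 'k::field mat set"
  where "vasilovsky n g =
    LinearCombinations.module.span class_ring (module_mat TYPE('k) n n)
      {matrix_unit n i j | i j. i < n \<and> j < n \<and> [int j - int i = g] (mod int n)}"

end

theory Submission
  imports Defs "Jordan_Normal_Form.Column_Operations"
begin

text \<open>
  A matrix algebra has so many inner automorphisms that a subspace of \<open>M\<^sub>n(K)\<close> which they preserve
  and whose members all have zero diagonal must be trivial: a transvection moves the entry at
  \<open>(p, q)\<close> onto the diagonal. The proof applies this to the values of \<open>f\<close>.

  Suppose that \<open>f\<close> vanishes on all homogeneous tuples of total degree \<open>0\<close>. Then every value \<open>f(b)\<close> has
  zero diagonal (\<open>diagonal_zero\<close>). Indeed, \<open>f\<close> is linear in each variable, so splitting every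
  \<open>b\<^sub>i\<close> into homogeneous components writes \<open>f(b)\<close> as a sum of values on homogeneous tuples. A
  tuple of total degree \<open>0\<close> contributes nothing by hypothesis. For a tuple of total degree
  \<open>g \<noteq> 0\<close>, all monomials of \<open>f\<close> use the same variables once each, so the value lies in
  \<open>A\<^sub>g\<close>, and a matrix in \<open>A\<^sub>g\<close> with \<open>g \<noteq> 0\<close> has zero diagonal.

  Now let \<open>p \<noteq> q\<close> and \<open>U = 1 + E\<^sub>q\<^sub>p\<close>. Substituting \<open>U b\<^sub>i U\<inverse>\<close> for \<open>b\<^sub>i\<close> turns \<open>f(b)\<close> into
  \<open>U f(b) U\<inverse>\<close> (\<open>word_eval_conjugate\<close>), whose entry at \<open>(q, q)\<close> is the sum of the entries of \<open>f(b)\<close> at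
  \<open>(q, q)\<close> and \<open>(p, q)\<close> (\<open>transvection_conjugate_index\<close>). The diagonal entries of both values
  vanish, so the entry of \<open>f(b)\<close> at \<open>(p, q)\<close> is zero as well.
\<close>

section \<open>Monomials and values of a multilinear polynomial\<close>

lemma prod_list_Var:
  "(\<Prod>i\<leftarrow>xs. Var (s i) :: 'k::semiring_1 free_algebra) = Poly_Mapping.single (Word (map s xs)) 1"
proof (induction xs)
  case Nil
  then show ?case by (simp flip: zero_nc_word_def)
next
  case (Cons x xs)
  then show ?case by (simp add: Var_def mult_single plus_nc_word_def)
qed

text \<open>Multilinearity enters the proof through the shape of the monomials: distinctness of the
  letters gives linearity in each variable, and the common letter set gives all monomials the same
  degree on a homogeneous tuple.\<close>

lemma multilinear_keys:
  fixes f :: "'k::field free_algebra"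
  assumes "multilinear m f" and "w \<in> Poly_Mapping.keys f"
  shows "distinct (letters w)" and "set (letters w) = {1..m}"
proof -
  from assms(1) obtain \<alpha> where "f = (\<Sum>\<sigma> | \<sigma> permutes {1..m}.
      Const (\<alpha> \<sigma>) * (\<Prod>i\<leftarrow>[1..<Suc m]. Var (\<sigma> i)))"
    unfolding multilinear_def by blast
  then have "f = (\<Sum>\<sigma> | \<sigma> permutes {1..m}. Poly_Mapping.single (Word (map \<sigma> [1..<Suc m])) (\<alpha> \<sigma>))"
    by (simp add: prod_list_Var Const_def mult_single del: upt_Suc)
  with assms(2) obtain \<sigma> where \<sigma>: "\<sigma> permutes {1..m}"
    and "w \<in> Poly_Mapping.keys (Poly_Mapping.single (Word (map \<sigma> [1..<Suc m])) (\<alpha> \<sigma>))"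
    using keys_sum by (metis (no_types, lifting) UN_E mem_Collect_eq subsetD)
  then have w: "letters w = map \<sigma> [1..<Suc m]"
    by (auto split: if_splits simp del: upt_Suc)
  show "distinct (letters w)"
    unfolding w distinct_map using permutes_inj_on[OF \<sigma>] by auto
  have "set [1..<Suc m] = {1..m}" by auto
  then show "set (letters w) = {1..m}"
    unfolding w set_map using permutes_image[OF \<sigma>] by simp
qed

lemma word_eval_Nil [simp]: "word_eval n a (Word []) = 1\<^sub>m n"
  by (simp add: word_eval_def)

lemma word_eval_Cons [simp]: "word_eval n a (Word (x # xs)) = a x * word_eval n a (Word xs)"
  by (simp add: word_eval_def)

lemma word_eval_carrier:
  assumes "\<forall>i\<in>set xs. a i \<in> carrier_mat n n"
  shows "word_eval n a (Word xs) \<in> carrier_mat n n"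
  using assms by (induction xs) auto

lemma word_eval_cong:
  assumes "\<forall>i\<in>set xs. a i = b i"
  shows "word_eval n a (Word xs) = word_eval n b (Word xs)"
  using assms by (induction xs) auto

lemma mult_mat_index:
  assumes "A \<in> carrier_mat n n" "B \<in> carrier_mat n n" "p < n" "q < n"
  shows "(A * B) $$ (p, q) = (\<Sum>r<n. A $$ (p, r) * B $$ (r, q))"
  using assms by (simp add: scalar_prod_def atLeast0LessThan)

lemma finsum_mat:
  fixes F :: "'b \<Rightarrow> 'k::field mat"
  assumes "finite S" and "\<forall>w\<in>S. F w \<in> carrier_mat n n"
  shows "(\<Oplus>\<^bsub>module_mat TYPE('k) n n\<^esub> w \<in> S. F w) \<in> carrier_mat n n"
    and "p < n \<Longrightarrow> q < n \<Longrightarrow> (\<Oplus>\<^bsub>module_mat TYPE('k) n n\<^esub> w \<in> S. F w) $$ (p, q) = (\<Sum>w\<in>S. F w $$ (p, q))"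
proof -
  interpret abelian_group "module_mat TYPE('k) n n" by (rule abelian_group_mat)
  show "(\<Oplus>\<^bsub>module_mat TYPE('k) n n\<^esub> w \<in> S. F w) \<in> carrier_mat n n"
    using finsum_closed[of F S] assms(2) by (auto simp: module_mat_simps)
  show "(\<Oplus>\<^bsub>module_mat TYPE('k) n n\<^esub> w \<in> S. F w) $$ (p, q) = (\<Sum>w\<in>S. F w $$ (p, q))"
    if "p < n" "q < n"
    using assms
  proof (induction S rule: finite_induct)
    case empty
    then show ?case using that by (simp add: module_mat_simps)
  next
    case (insert x T)
    have "(\<Oplus>\<^bsub>module_mat TYPE('k) n n\<^esub> w \<in> T. F w) \<in> carrier_mat n n"
      using finsum_closed[of F T] insert.prems by (auto simp: module_mat_simps)
    then show ?case
      using insert that by (subst finsum_insert) (auto simp: module_mat_simps)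
  qed
qed

text \<open>Values of \<open>f\<close> are studied entry by entry, which replaces the sum in the module of matrices by
  a sum of scalars.\<close>

lemma
  fixes f :: "'k::field free_algebra"
  assumes "multilinear m f" and "\<forall>i\<in>{1..m}. a i \<in> carrier_mat n n"
  shows poly_eval_carrier: "poly_eval n a f \<in> carrier_mat n n"
    and poly_eval_index: "p < n \<Longrightarrow> q < n \<Longrightarrow> poly_eval n a f $$ (p, q) =
      (\<Sum>w\<in>Poly_Mapping.keys f. Poly_Mapping.lookup f w * word_eval n a w $$ (p, q))"
proof -
  have W: "word_eval n a w \<in> carrier_mat n n" if "w \<in> Poly_Mapping.keys f" for w
    using word_eval_carrier[of "letters w" a n] multilinear_keys(2)[OF assms(1) that] assms(2) by simp
  then have W': "\<forall>w\<in>Poly_Mapping.keys f. Poly_Mapping.lookup f w \<cdot>\<^sub>m word_eval n a w \<in> carrier_mat n n"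
    by simp
  show "poly_eval n a f \<in> carrier_mat n n"
    unfolding poly_eval_def by (rule finsum_mat(1)[OF finite_keys W'])
  assume pq: "p < n" "q < n"
  show "poly_eval n a f $$ (p, q) =
      (\<Sum>w\<in>Poly_Mapping.keys f. Poly_Mapping.lookup f w * word_eval n a w $$ (p, q))"
    unfolding poly_eval_def finsum_mat(2)[OF finite_keys W' pq]
  proof (rule sum.cong[OF refl])
    fix w assume "w \<in> Poly_Mapping.keys f"
    from W[OF this] pq show "(Poly_Mapping.lookup f w \<cdot>\<^sub>m word_eval n a w) $$ (p, q)
        = Poly_Mapping.lookup f w * word_eval n a w $$ (p, q)"
      by auto
  qed
qed

section \<open>The Vasilovsky grading\<close>

text \<open>Membership in \<open>A\<^sub>g\<close> described by the support of the matrix rather than by a span.\<close>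

definition homogeneous :: "nat \<Rightarrow> int \<Rightarrow> 'k::field mat \<Rightarrow> bool"
  where "homogeneous n g M \<longleftrightarrow> M \<in> carrier_mat n n \<and>
    (\<forall>i<n. \<forall>j<n. M $$ (i, j) \<noteq> 0 \<longrightarrow> [int j - int i = g] (mod int n))"

lemma vasilovsky_carrier: "vasilovsky n g \<subseteq> (carrier_mat n n :: 'k::field mat set)"
proof -
  interpret vectorspace class_ring "module_mat TYPE('k) n n" by (rule matrix_vs)
  have "span {matrix_unit n i j | i j. i < n \<and> j < n \<and> [int j - int i = g] (mod int n)}
      \<subseteq> carrier (module_mat TYPE('k) n n)"
    by (rule span_is_subset2) (auto simp: module_mat_simps matrix_unit_def)
  then show ?thesis by (simp add: vasilovsky_def module_mat_simps)
qed

text \<open>A matrix is the combination of the matrix units on its support, with its entries as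
  coefficients. The induction builds it up one entry at a time.\<close>

lemma homogeneous_vasilovsky:
  fixes M :: "'k::field mat"
  assumes "homogeneous n g M"
  shows "M \<in> vasilovsky n g"
proof -
  interpret vectorspace class_ring "module_mat TYPE('k) n n" by (rule matrix_vs)
  let ?B = "{matrix_unit n i j | i j. i < n \<and> j < n \<and> [int j - int i = g] (mod int n)} :: 'k mat set"
  have B: "?B \<subseteq> carrier (module_mat TYPE('k) n n)"
    by (auto simp: module_mat_simps matrix_unit_def)
  have M: "M \<in> carrier_mat n n" using assms by (simp add: homogeneous_def)
  have sub: "submodule class_ring (span ?B) (module_mat TYPE('k) n n)"
    using span_is_submodule[OF B] .
  have "mat n n (\<lambda>(i, j). if (i, j) \<in> S then M $$ (i, j) else 0) \<in> span ?B"
    if "S \<subseteq> {..<n} \<times> {..<n}" for S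
    using finite_subset[OF that finite_cartesian_product[OF finite_lessThan finite_lessThan]] that
  proof (induction S rule: finite_induct)
    case empty
    have "mat n n (\<lambda>(i, j). if (i, j) \<in> {} then M $$ (i, j) else 0) = 0\<^sub>m n n"
      by (intro eq_matI) auto
    then show ?case
      using submodule.zero_closed[OF sub] by (simp only: module_mat_simps)
  next
    case (insert x S)
    obtain k l where x: "x = (k, l)" by (cases x)
    have kl: "k < n" "l < n" using insert.prems x by auto
    let ?R = "\<lambda>S. mat n n (\<lambda>(i, j). if (i, j) \<in> S then M $$ (i, j) else 0)"
    show ?case
    proof (cases "M $$ (k, l) = 0")
      case True
      have "?R (insert x S) = ?R S" using True x by (intro eq_matI) auto
      moreover have "?R S \<in> span ?B" using insert by blast
      ultimately show ?thesis by (simp only:)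
    next
      case False
      then have "matrix_unit n k l \<in> ?B" using assms kl by (auto simp: homogeneous_def)
      then have "matrix_unit n k l \<in> span ?B" using in_own_span[OF B] by blast
      then have "M $$ (k, l) \<cdot>\<^sub>m matrix_unit n k l \<in> span ?B"
        using submodule.smult_closed[OF sub, of "M $$ (k, l)"] by (simp add: module_mat_simps)
      moreover have "?R S \<in> span ?B" using insert by blast
      ultimately have "M $$ (k, l) \<cdot>\<^sub>m matrix_unit n k l + ?R S \<in> span ?B"
        using submodule.m_closed[OF sub] by (simp add: module_mat_simps)
      moreover have "M $$ (k, l) \<cdot>\<^sub>m matrix_unit n k l + ?R S = ?R (insert x S)"
        using kl x insert.hyps by (intro eq_matI) (auto simp: matrix_unit_def)
      ultimately show ?thesis by (simp only:)
    qed
  qed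
  from this[of "{..<n} \<times> {..<n}"]
  have "mat n n (\<lambda>(i, j). if (i, j) \<in> {..<n} \<times> {..<n} then M $$ (i, j) else 0) \<in> span ?B" by simp
  also have "mat n n (\<lambda>(i, j). if (i, j) \<in> {..<n} \<times> {..<n} then M $$ (i, j) else 0) = M"
    using M by (intro eq_matI) auto
  finally show ?thesis unfolding vasilovsky_def .
qed

text \<open>Degrees add along a product since a nonzero entry at \<open>(i, j)\<close> comes from some \<open>r\<close> with nonzero
  entries at \<open>(i, r)\<close> and \<open>(r, j)\<close>, and \<open>(r - i) + (j - r) = j - i\<close>.\<close>

lemma homogeneous_mult:
  assumes "homogeneous n g A" and "homogeneous n h B"
  shows "homogeneous n (g + h) (A * B)"
proof -
  have C: "A \<in> carrier_mat n n" "B \<in> carrier_mat n n" using assms by (auto simp: homogeneous_def)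
  have "[int j - int i = g + h] (mod int n)" if ij: "i < n" "j < n" and nz: "(A * B) $$ (i, j) \<noteq> 0" for i j
  proof -
    from nz obtain r where "r < n" "A $$ (i, r) \<noteq> 0" "B $$ (r, j) \<noteq> 0"
      unfolding mult_mat_index[OF C ij] by (metis (no_types, lifting) lessThan_iff mult_eq_0_iff sum.neutral)
    then have "[int r - int i = g] (mod int n)" "[int j - int r = h] (mod int n)"
      using assms ij by (auto simp: homogeneous_def)
    from cong_add[OF this] show ?thesis by simp
  qed
  with C show ?thesis by (simp add: homogeneous_def)
qed

lemma word_eval_homogeneous:
  assumes "\<forall>i\<in>set xs. homogeneous n (g i) (a i)"
  shows "homogeneous n (\<Sum>i\<leftarrow>xs. g i) (word_eval n a (Word xs))"
  using assms
proof (induction xs)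
  case Nil
  then show ?case by (auto simp: homogeneous_def)
next
  case (Cons x xs)
  then show ?case by (auto intro: homogeneous_mult)
qed

text \<open>Additivity in one slot, in a form that fits the decomposition of the \<open>k\<close>th matrix into
  components. Exactly one factor of the product changes because the letter \<open>k\<close> occurs exactly
  once.\<close>

lemma word_eval_additive:
  assumes "distinct xs" and "k \<in> set xs" and "\<forall>i\<in>set xs. b i \<in> carrier_mat n n"
    and "\<forall>h\<in>H. c h \<in> carrier_mat n n"
    and "\<forall>i<n. \<forall>j<n. b k $$ (i, j) = (\<Sum>h\<in>H. c h $$ (i, j))"
    and "p < n" and "q < n"
  shows "word_eval n b (Word xs) $$ (p, q) = (\<Sum>h\<in>H. word_eval n (b(k := c h)) (Word xs) $$ (p, q))"
  using assms
proof (induction xs arbitrary: p q)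
  case Nil
  then show ?case by simp
next
  case (Cons x xs)
  have W: "word_eval n b (Word xs) \<in> carrier_mat n n"
    using Cons.prems by (intro word_eval_carrier) auto
  have W': "word_eval n (b(k := c h)) (Word xs) \<in> carrier_mat n n" if "h \<in> H" for h
    using Cons.prems that by (intro word_eval_carrier) auto
  show ?case
  proof (cases "x = k")
    case True
    have same: "word_eval n (b(k := c h)) (Word xs) = word_eval n b (Word xs)" for h
      using Cons.prems True by (intro word_eval_cong) auto
    have "word_eval n b (Word (x # xs)) $$ (p, q)
        = (\<Sum>r<n. (\<Sum>h\<in>H. c h $$ (p, r)) * word_eval n b (Word xs) $$ (r, q))"
      using Cons.prems W True by (simp add: mult_mat_index[where n = n] del: index_mult_mat)
    also have "\<dots> = (\<Sum>h\<in>H. \<Sum>r<n. c h $$ (p, r) * word_eval n b (Word xs) $$ (r, q))"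
      unfolding sum_distrib_right by (rule sum.swap)
    also have "\<dots> = (\<Sum>h\<in>H. word_eval n (b(k := c h)) (Word (x # xs)) $$ (p, q))"
      using Cons.prems W True by (intro sum.cong) (simp_all add: same mult_mat_index[where n = n] del: index_mult_mat)
    finally show ?thesis .
  next
    case False
    have IH: "word_eval n b (Word xs) $$ (r, q) = (\<Sum>h\<in>H. word_eval n (b(k := c h)) (Word xs) $$ (r, q))"
      if "r < n" for r
      using Cons.prems False that by (intro Cons.IH) auto
    have "word_eval n b (Word (x # xs)) $$ (p, q)
        = (\<Sum>r<n. b x $$ (p, r) * (\<Sum>h\<in>H. word_eval n (b(k := c h)) (Word xs) $$ (r, q)))"
      using Cons.prems W by (simp add: mult_mat_index[where n = n] IH del: index_mult_mat)
    also have "\<dots> = (\<Sum>h\<in>H. \<Sum>r<n. b x $$ (p, r) * word_eval n (b(k := c h)) (Word xs) $$ (r, q))"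
      unfolding sum_distrib_left by (rule sum.swap)
    also have "\<dots> = (\<Sum>h\<in>H. word_eval n (b(k := c h)) (Word (x # xs)) $$ (p, q))"
      using Cons.prems W' False by (intro sum.cong) (simp_all add: mult_mat_index[where n = n] del: index_mult_mat)
    finally show ?thesis .
  qed
qed

definition component :: "nat \<Rightarrow> 'k::field mat \<Rightarrow> int \<Rightarrow> 'k mat"
  where "component n M h =
    mat n n (\<lambda>(i, j). if [int j - int i = h] (mod int n) then M $$ (i, j) else 0)"

lemma homogeneous_component: "homogeneous n h (component n M h)"
  by (auto simp: homogeneous_def component_def)

text \<open>The integers \<open>0, \<dots>, n - 1\<close> represent each degree once, so each entry survives in exactly
  one component.\<close>

lemma sum_component:
  assumes "i < n" and "j < n"
  shows "M $$ (i, j) = (\<Sum>h\<in>{0..<int n}. component n M h $$ (i, j))"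
proof -
  have "(\<Sum>h\<in>{0..<int n}. component n M h $$ (i, j))
      = (\<Sum>h\<in>{0..<int n}. if h = (int j - int i) mod int n then M $$ (i, j) else 0)"
    using assms by (intro sum.cong) (auto simp: component_def cong_def)
  also have "\<dots> = M $$ (i, j)"
    using assms by simp
  finally show ?thesis by simp
qed

section \<open>Conjugation\<close>

text \<open>Inner factors \<open>V * U\<close> cancel between neighbouring letters; for the empty word the identity is
  \<open>U * V = 1\<close>.\<close>

lemma word_eval_conjugate:
  assumes U: "U \<in> carrier_mat n n" and V: "V \<in> carrier_mat n n"
    and UV: "U * V = 1\<^sub>m n" and VU: "V * U = 1\<^sub>m n"
    and "\<forall>i\<in>set xs. b i \<in> carrier_mat n n"
  shows "word_eval n (\<lambda>i. U * b i * V) (Word xs) = U * word_eval n b (Word xs) * V"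
  using assms(5)
proof (induction xs)
  case Nil
  then show ?case using U UV by simp
next
  case (Cons x xs)
  define W where "W = word_eval n b (Word xs)"
  have W: "W \<in> carrier_mat n n" unfolding W_def using Cons.prems by (intro word_eval_carrier) auto
  have B: "b x \<in> carrier_mat n n" using Cons.prems by simp
  have "(U * b x * V) * (U * W * V) = U * b x * (V * U) * (W * V)"
    using U V B W by (simp add: assoc_mult_mat[of _ n n _ n _ n])
  also have "\<dots> = U * (b x * W) * V"
    using U V B W by (simp add: VU assoc_mult_mat[of _ n n _ n _ n])
  finally show ?case using Cons by (simp flip: W_def)
qed

text \<open>Multiplication by \<open>1 + E\<^sub>q\<^sub>p\<close> on the left adds row \<open>p\<close> to row \<open>q\<close>, and multiplication by its
  inverse \<open>1 - E\<^sub>q\<^sub>p\<close> on the right subtracts column \<open>q\<close> from column \<open>p\<close>. As \<open>p \<noteq> q\<close>, the second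
  step leaves the entry at \<open>(q, q)\<close> alone.\<close>

lemma transvection_conjugate_index:
  fixes W :: "'k::field mat"
  assumes W: "W \<in> carrier_mat n n" and "p < n" and "q < n" and "p \<noteq> q"
  shows "(addrow_mat n 1 q p * W * addrow_mat n (- 1) q p) $$ (q, q) = W $$ (q, q) + W $$ (p, q)"
proof -
  have "addrow_mat n 1 q p * W * addrow_mat n (- 1) q p = addcol (- 1) p q (addrow 1 q p W)"
    using addrow_mat[OF W \<open>p < n\<close>, of 1 q]
      addcol_mat[OF mult_carrier_mat[OF addrow_mat_carrier W] \<open>q < n\<close>, of "- 1" p 1 q p]
    by simp
  then show ?thesis using assms by auto
qed

section \<open>Reduction to total degree zero\<close>

text \<open>The slots are made homogeneous one at a time, so the induction is over the number \<open>k\<close> of slots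
  that are still arbitrary, with the slots after \<open>k\<close> already homogeneous of degrees \<open>g\<close>. At
  \<open>k = 0\<close> either the hypothesis applies, or the value has a nonzero degree while diagonal entries
  sit in degree \<open>0\<close>.\<close>

lemma diagonal_zero:
  fixes f :: "'k::field free_algebra"
  assumes f: "multilinear m f"
    and zero: "\<And>a g. (\<forall>i\<in>{1..m}. homogeneous n (g i) (a i)) \<Longrightarrow> [(\<Sum>i=1..m. g i) = 0] (mod int n)
      \<Longrightarrow> poly_eval n a f = 0\<^sub>m n n"
    and b: "\<forall>i\<in>{1..m}. b i \<in> carrier_mat n n" and p: "p < n"
  shows "poly_eval n b f $$ (p, p) = 0"
proof -
  have "poly_eval n b f $$ (p, p) = 0"
    if "k \<le> m" and "\<forall>i\<in>{1..m}. b i \<in> carrier_mat n n" and "\<forall>i\<in>{k<..m}. homogeneous n (g i) (b i)"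
    for k b g
    using that
  proof (induction k arbitrary: b g)
    case 0
    then have hom: "\<forall>i\<in>{1..m}. homogeneous n (g i) (b i)" by auto
    show ?case
    proof (cases "[(\<Sum>i=1..m. g i) = 0] (mod int n)")
      case True
      then show ?thesis using zero[OF hom] p by simp
    next
      case False
      have "word_eval n b w $$ (p, p) = 0" if w: "w \<in> Poly_Mapping.keys f" for w
      proof (rule ccontr)
        assume nz: "word_eval n b w $$ (p, p) \<noteq> 0"
        note K = multilinear_keys[OF f w]
        have "homogeneous n (\<Sum>i\<leftarrow>letters w. g i) (word_eval n b (Word (letters w)))"
          using hom K by (intro word_eval_homogeneous) auto
        moreover have "(\<Sum>i\<leftarrow>letters w. g i) = (\<Sum>i=1..m. g i)"
          using K by (simp add: sum_list_distinct_conv_sum_set)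
        ultimately have "[int p - int p = (\<Sum>i=1..m. g i)] (mod int n)"
          using nz p unfolding homogeneous_def by (metis nc_word.collapse)
        with False show False by (simp add: cong_sym)
      qed
      then show ?thesis using poly_eval_index[OF f 0(2) p p] by simp
    qed
  next
    case (Suc k)
    let ?b = "\<lambda>h. b(Suc k := component n (b (Suc k)) h)"
    have cc: "component n (b (Suc k)) h \<in> carrier_mat n n" for h by (simp add: component_def)
    have bc: "\<forall>i\<in>{1..m}. ?b h i \<in> carrier_mat n n" for h using Suc.prems cc by auto
    have "word_eval n b w $$ (p, p) = (\<Sum>h\<in>{0..<int n}. word_eval n (?b h) w $$ (p, p))"
      if w: "w \<in> Poly_Mapping.keys f" for w
    proof -
      note K = multilinear_keys[OF f w]
      have "Suc k \<in> set (letters w)" and "\<forall>i\<in>set (letters w). b i \<in> carrier_mat n n"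
        using K Suc.prems by auto
      moreover have "\<forall>i<n. \<forall>j<n. b (Suc k) $$ (i, j) = (\<Sum>h\<in>{0..<int n}. component n (b (Suc k)) h $$ (i, j))"
        by (intro allI impI sum_component)
      ultimately have "word_eval n b (Word (letters w)) $$ (p, p)
          = (\<Sum>h\<in>{0..<int n}. word_eval n (?b h) (Word (letters w)) $$ (p, p))"
        using K(1) cc p by (intro word_eval_additive) simp_all
      then show ?thesis by simp
    qed
    then have "poly_eval n b f $$ (p, p)
        = (\<Sum>w\<in>Poly_Mapping.keys f. \<Sum>h\<in>{0..<int n}. Poly_Mapping.lookup f w * word_eval n (?b h) w $$ (p, p))"
      using poly_eval_index[OF f Suc.prems(2) p p] by (simp add: sum_distrib_left)
    also have "\<dots> = (\<Sum>h\<in>{0..<int n}. poly_eval n (?b h) f $$ (p, p))"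
      unfolding poly_eval_index[OF f bc p p] by (rule sum.swap)
    also have "\<dots> = 0"
    proof (intro sum.neutral ballI)
      fix h
      have "\<forall>i\<in>{k<..m}. homogeneous n ((g(Suc k := h)) i) (?b h i)"
        using Suc.prems(3) homogeneous_component by auto
      then show "poly_eval n (?b h) f $$ (p, p) = 0"
        using Suc.IH[OF Suc_leD[OF Suc.prems(1)] bc, of "g(Suc k := h)"] by blast
    qed
    finally show ?case .
  qed
  from this[of m b "\<lambda>_. 0"] b show ?thesis by simp
qed

theorem theorem3p1:
  fixes f :: "'k::field free_algebra" and n m :: nat
  assumes "n \<ge> 1" and "m \<ge> 1" and "multilinear m f"
  shows "polynomial_identity n m f \<longleftrightarrow>
    (\<forall>(a :: nat \<Rightarrow> 'k mat) (g :: nat \<Rightarrow> int).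
      (\<forall>i\<in>{1..m}. a i \<in> vasilovsky n (g i)) \<and> [(\<Sum>i=1..m. g i) = 0] (mod int n)
      \<longrightarrow> poly_eval n a f = 0\<^sub>m n n)"
    (is "_ \<longleftrightarrow> ?graded")
proof
  assume "polynomial_identity n m f"
  then show ?graded
    unfolding polynomial_identity_def using vasilovsky_carrier by blast
next
  assume ?graded
  then have zero: "poly_eval n a f = 0\<^sub>m n n"
    if "\<forall>i\<in>{1..m}. homogeneous n (g i) (a i)" and "[(\<Sum>i=1..m. g i) = 0] (mod int n)" for a g
    using that homogeneous_vasilovsky by blast
  note diag = diagonal_zero[OF assms(3) zero]
  show "polynomial_identity n m f"
    unfolding polynomial_identity_def
  proof (intro allI impI)
    fix b :: "nat \<Rightarrow> 'k mat"
    assume b: "\<forall>i\<in>{1..m}. b i \<in> carrier_mat n n"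
    have "poly_eval n b f $$ (p, q) = 0" if p: "p < n" and q: "q < n" for p q
    proof (cases "p = q")
      case True
      then show ?thesis using diag[OF _ _ b p] by simp
    next
      case False
      \<comment> \<open>Row \<open>p\<close> is added to row \<open>q\<close>, which carries the entry at \<open>(p, q)\<close> to \<open>(q, q)\<close>.\<close>
      define U V :: "'k mat" where "U = addrow_mat n 1 q p" and "V = addrow_mat n (- 1) q p"
      have UV: "U \<in> carrier_mat n n" "V \<in> carrier_mat n n" "U * V = 1\<^sub>m n" "V * U = 1\<^sub>m n"
        using addrow_mat_inv[OF q p, of 1] addrow_mat_inv[OF q p, of "- 1"] False
        by (auto simp: U_def V_def)
      have c: "\<forall>i\<in>{1..m}. U * b i * V \<in> carrier_mat n n" using b UV(1,2) by auto
      have "word_eval n (\<lambda>i. U * b i * V) w $$ (q, q) = word_eval n b w $$ (q, q) + word_eval n b w $$ (p, q)"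
        if w: "w \<in> Poly_Mapping.keys f" for w
      proof -
        have "\<forall>i\<in>set (letters w). b i \<in> carrier_mat n n"
          using b multilinear_keys(2)[OF assms(3) w] by simp
        from word_eval_conjugate[OF UV this] word_eval_carrier[OF this]
        show ?thesis using transvection_conjugate_index[OF _ p q False] by (simp add: U_def V_def)
      qed
      then have "poly_eval n (\<lambda>i. U * b i * V) f $$ (q, q)
          = poly_eval n b f $$ (q, q) + poly_eval n b f $$ (p, q)"
        unfolding poly_eval_index[OF assms(3) c q q] poly_eval_index[OF assms(3) b q q]
          poly_eval_index[OF assms(3) b p q]
        by (simp add: distrib_left sum.distrib)
      then show ?thesis using diag[OF _ _ b q] diag[OF _ _ c q] by simp
    qed
    then show "poly_eval n b f = 0\<^sub>m n n"
      using poly_eval_carrier[OF assms(3) b] by (intro eq_matI) auto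
  qed
qed

end
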